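(* Let $G$ be a nonempty Dots & Boxes position consisting of loops and long chains. Write $v=v(G)$, $c=c(G)$, let $\theta$ be the number of $3$-chains in $G$ and $f$ the number of $4$-loops in $G$. Then $v$ is given by the first of the following cases that applies: (1) If $c\ge 2$ then $v=c$. (2) If $c=0$ and $G=4_\ell+H$ with $H$ any (possibly empty) position other than $3+3$, then $v=0$. (3) If $\theta=0$, or if $\theta=1$ and $\mathrm{size}(G)\equiv 3\pmod 4$, then: (a) if $c+4f\ge 2$ then $v=0,1,2,3,4$ according to whether $c\equiv 0,\pm1,\pm2,\pm3,4 \pmod 8$ respectively; (b) if $c+4f<2$ then: (i) if $\mathrm{size}(G)$ is odd then $v=1$ if $f$ is odd and $v=3$ if $f$ is even; (ii) if $\mathrm{size}(G)\equiv 2\pmod 4$ then $v=2$; (iii) if $\mathrm{size}(G)\equiv 0\pmod 4$ then $v=0$ if $f$ is odd and $v=4$ if $f$ is even. (4) In all other cases, $v=1$ if $\mathrm{size}(G)$ is odd and $v=2$ if $\mathrm{size}(G)$ is even.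
   Context: Positions. A (Dots & Boxes) position $G$ consisting of loops and long chains is a finite multiset of components, each of which is either a chain of some integer length $\ge 3$ (a "long chain", or just "chain") or a loop of some even integer length $\ge 4$. All components are unopened. An $N$-chain is written $N$ and an $N$-loop is written $N_\ell$; positions are written additively (e.g. $3+4_\ell+8_\ell$ is a $3$-chain, a $4$-loop and an $8$-loop), and $G-C$ denotes $G$ with the component $C$ removed. $\mathrm{size}(G)$ is the sum of the lengths of the components (the number of unclaimed boxes); $\mathrm{size}(C)$ is the length of the component $C$. Play and value. In a nonempty position the player to move (the opener) must choose a component $C$ to open. The other player (the controller) then either gives up control, i.e. captures all boxes of $C$ and becomes the opener in $G-C$, or keeps control, i.e. captures all but $2$ boxes of $C$ if $C$ is a chain (all but $4$ if $C$ is a loop), the leftover boxes being captured by the opener, who is then again the opener in $G-C$. Each player maximizes the number of boxes he captures. The value $v(G)$ is the margin by which the controller outscores the opener in $G$ under optimal play, and $v(G;C)$ is this margin given that the opener has just opened $C$. So $v(\emptyset)=0$, $v(G)=\min_C v(G;C)$ over the components $C$ of a nonempty $G$, and $$v(G;C)=\max\{\mathrm{size}(C)-2k+v(G-C),\ \mathrm{size}(C)-v(G-C)\}=(\mathrm{size}(C)-k)+|v(G-C)-k|,$$ with $k=2$ if $C$ is a chain and $k=4$ if $C$ is a loop. Controlled value. $c(G)=\mathrm{size}(G)-4(\text{number of chains})-8(\text{number of loops})+\mathrm{tb}(G)$, where the terminal bonus $\mathrm{tb}(G)$ is $0$ if $G$ is empty; $8$ if $G$ consists of one or more loops and nothing else;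 $6$ if $G$ consists of one or more loops and one or more $3$-chains and nothing else; and $4$ otherwise. *)

theory Defs
  imports "HOL-Library.Multiset" "HOL-Number_Theory.Cong"
begin

datatype component = is_chain: Chain (len: nat) | is_loop: Loop (len: nat)

text \<open>Every chain occurring in a position is long.\<close>

fun valid_component :: "component \<Rightarrow> bool" where
  "valid_component (Chain n) \<longleftrightarrow> n \<ge> 3"
| "valid_component (Loop n) \<longleftrightarrow> n \<ge> 4 \<and> even n"

definition position :: "component multiset \<Rightarrow> bool" where
  "position G \<longleftrightarrow> (\<forall>C\<in>#G. valid_component C)"

definition boxes :: "component multiset \<Rightarrow> nat" where
  "boxes G = (\<Sum>C\<in>#G. len C)"

text \<open>The number of boxes the controller leaves to the opener in order to keep control.\<close>

fun sacrifice :: "component \<Rightarrow> nat" where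
  "sacrifice (Chain n) = 2"
| "sacrifice (Loop n) = 4"

text \<open>The controller's optimal margin when the component \<open>C\<close> has just been opened and
  \<open>w\<close> is the value of the rest of the position.  The first option keeps control: the
  controller takes all but \<open>k = sacrifice C\<close> boxes, the opener takes these \<open>k\<close>, and the roles
  stay the same.  The second option gives up control: the controller takes all boxes and
  the roles are exchanged.\<close>

definition opened_value :: "component \<Rightarrow> int \<Rightarrow> int" where
  "opened_value C w =
     max (int (len C) - 2 * int (sacrifice C) + w) (int (len C) - w)"

text \<open>The margin by which the controller outscores the opener under optimal play.\<close>

function game_value :: "component multiset \<Rightarrow> int" where
  "game_value G =
     (if G = {#} then 0
      else Min ((\<lambda>C. opened_value C (game_value (G - {#C#}))) ` set_mset G))"
  by auto
termination
  by (relation "measure size") (auto intro: size_Diff1_less)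

declare game_value.simps [simp del]

definition terminal_bonus :: "component multiset \<Rightarrow> int" where
  "terminal_bonus G =
     (if G = {#} then 0
      else if \<forall>C\<in>#G. is_loop C then 8
      else if (\<exists>C\<in>#G. is_loop C) \<and> Chain 3 \<in># G \<and>
              (\<forall>C\<in>#G. is_loop C \<or> C = Chain 3) then 6
      else 4)"

definition controlled_value :: "component multiset \<Rightarrow> int" where
  "controlled_value G =
     int (boxes G) - 4 * int (size (filter_mset is_chain G))
       - 8 * int (size (filter_mset is_loop G)) + terminal_bonus G"

end

theory Submission
  imports Defs
begin

text \<open>
  Suppose a component of length \<open>n\<close> with sacrifice \<open>k\<close> is opened and the rest has value \<open>w\<close>.  The
  result is \<open>n - k + \<bar>w - k\<bar>\<close>.  As long as \<open>w \<ge> k\<close> the controller stays in control, and the component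
  adds its excess \<open>n - 2 * k\<close> to the value.  Summing the excesses, and correcting for the last
  component opened, where no sacrifice is made, gives the controlled value \<open>c\<close>.  It is therefore a
  lower bound for the value (\<open>closed_form_ge\<close>), and the opener can hold the controller to it when
  \<open>c \<ge> 2\<close>.

  When \<open>c < 2\<close> the absolute values begin to fold.  A 4-loop turns \<open>w\<close> into \<open>\<bar>w - 4\<bar>\<close>, for \<open>w \<le> 4\<close> a
  reflection at 2; a 6-loop turns \<open>w \<le> 4\<close> into \<open>6 - w\<close>, a reflection at 3; a 3-chain turns \<open>w\<close> into
  \<open>1 + \<bar>w - 2\<bar>\<close>, which for \<open>0 \<le> w \<le> 4\<close> is 2 if \<open>w\<close> is odd, 1 if \<open>w = 2\<close>, and 3 otherwise.  So either 3-chains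
  drive the value to 1 or 2, according to parity, or they are useless to the opener and the value is
  governed by reflections.  The first fails exactly for tame positions: those without 3-chains, and
  those with one 3-chain and a number of boxes congruent to 3 modulo 4, whose 3-chain leaves a rest
  of value 0 or 4 when this value is at most 4.  In tame positions 4-loops are opened first, and the
  repeated reflections give a zigzag of period 8 in \<open>c\<close>; if the 4-loops run out too early, the
  reflections by 6-loops give a zigzag of period 4, which the 4-loops then reflect back and forth
  (\<open>low\<close>, \<open>low_shift\<close>).  Finally \<open>c = 0\<close> with a 4-loop has value 0, since the 4-loop can be opened
  leaving a rest of value 4.  The exception is \<open>4-loop + 3 + 3\<close>, where removing the only loop also
  changes the terminal bonus.

  The value is the unique solution of its recursion, so the closed form need only be checked to be
  a lower bound for all openings (\<open>predicted_le_opened_value\<close>) and to be attained by one of them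
  (\<open>ex_optimal_opening\<close>).  It depends on few data of the position: the numbers of 3-chains, 4-loops,
  loops and longer chains, and the excess.  Hence both checks are inequalities between integers, one
  for each kind of component.
\<close>

section \<open>Folding at multiples of 4 and 8\<close>

lemma mod_4_pred: "(a - 1) mod 4 = 3 \<longleftrightarrow> a mod 4 = 0" for a :: int by presburger

lemma mod_4_3_odd: "a mod 4 = 3 \<Longrightarrow> odd a" for a :: int by presburger

text \<open>The distance from \<open>c\<close> to the nearest multiple of \<open>n\<close>, for positive \<open>n\<close>.\<close>
definition dist_mult :: "int \<Rightarrow> int \<Rightarrow> int" where
  "dist_mult n c = min (c mod n) (n - c mod n)"

lemma dist_mult_8_shift: "dist_mult 8 (c - 4) = 4 - dist_mult 8 c"
proof -
  define r where "r = c mod 8"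
  have "r \<in> {0..7}" by (auto simp: r_def)
  then have "r \<in> {0, 1, 2, 3, 4, 5, 6, 7}" by (simp only: atLeastAtMost_iff insert_iff) linarith
  moreover have "(c - 4) mod 8 = (r - 4) mod 8" by (simp add: r_def mod_diff_left_eq)
  ultimately show ?thesis unfolding dist_mult_def r_def[symmetric] by auto
qed

lemma dist_mult_4_shift: "dist_mult 4 (c - 4) = dist_mult 4 c"
  by (simp add: dist_mult_def)

lemma dist_mult_4_shift_2: "dist_mult 4 (c - 2) = 2 - dist_mult 4 c"
proof -
  define r where "r = c mod 4"
  have "r \<in> {0..3}" by (auto simp: r_def)
  then have "r \<in> {0, 1, 2, 3}" by (simp only: atLeastAtMost_iff insert_iff) linarith
  moreover have "(c - 2) mod 4 = (r - 2) mod 4" by (simp add: r_def mod_diff_left_eq)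
  ultimately show ?thesis unfolding dist_mult_def r_def[symmetric] by auto
qed

lemma dist_mult_8_range: "0 \<le> dist_mult 8 c" "dist_mult 8 c \<le> 4"
  by (auto simp: dist_mult_def min_def)

lemma dist_mult_4_range: "0 \<le> dist_mult 4 c" "dist_mult 4 c \<le> 2"
  by (auto simp: dist_mult_def min_def)

lemma dist_mult_8_small: "0 \<le> c \<Longrightarrow> c \<le> 4 \<Longrightarrow> dist_mult 8 c = c"
  by (simp add: dist_mult_def)

lemma even_dist_mult_8: "even (dist_mult 8 c) \<longleftrightarrow> even c"
  by (simp add: dist_mult_def min_def dvd_mod_iff)

lemma even_dist_mult_4: "even (dist_mult 4 c) \<longleftrightarrow> even c"
  by (simp add: dist_mult_def min_def dvd_mod_iff)

lemma dist_mult_8_mod_4: "even c \<Longrightarrow> dist_mult 8 c mod 4 = c mod 4"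
proof -
  assume "even c"
  then have "c mod 8 = 0 \<or> c mod 8 = 2 \<or> c mod 8 = 4 \<or> c mod 8 = 6" by presburger
  moreover have "c mod 4 = c mod 8 mod 4" by (simp add: mod_mod_cancel)
  ultimately show ?thesis unfolding dist_mult_def by auto
qed

lemma dist_mult_4_mod_4: "even c \<Longrightarrow> dist_mult 4 c = c mod 4"
proof -
  assume "even c"
  then have "c mod 4 = 0 \<or> c mod 4 = 2" by presburger
  then show ?thesis unfolding dist_mult_def by auto
qed

text \<open>The value of a tame position (see below) with controlled value \<open>c < 2\<close> and \<open>f\<close> many 4-loops.
Opening a 4-loop turns a value \<open>w \<le> 4\<close> of the rest into \<open>4 - w\<close>, where the rest has controlled
value \<open>c + 4\<close> if its bonus is the same.  If there are enough 4-loops to climb back to a controlled value of at least 2, that is, if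
\<open>c + 4 * f \<ge> 2\<close>, these reflections give the zigzag \<open>dist_mult 8\<close>.  Otherwise the 4-loops are used up
while the controlled value \<open>c + 4 * f\<close> of what remains is still below 2.  What remains has the value
\<open>4 - dist_mult 4\<close>, because each 6-loop turns \<open>w \<le> 4\<close> into \<open>6 - w\<close> and a single 3-chain turns 0 and 4
into 3; this value is then reflected \<open>f\<close> times.\<close>
definition low :: "int \<Rightarrow> int \<Rightarrow> int" where
  "low c f =
     (if c + 4 * f \<ge> 2 then dist_mult 8 c
      else if even f then 4 - dist_mult 4 c
      else dist_mult 4 c)"

text \<open>The defining property of \<open>low\<close>: one further 4-loop reflects the value at 2.  In the first branch
this is the reflection of \<open>dist_mult 8\<close> under a shift by 4; in the other two the shift leaves
\<open>dist_mult 4\<close> alone and the parity of \<open>f\<close> changes.\<close>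
lemma low_shift: "low (c - 4) (f + 1) = 4 - low c f"
  by (simp add: low_def dist_mult_8_shift dist_mult_4_shift)

lemma low_range: "0 \<le> low c f" "low c f \<le> 4"
  using dist_mult_8_range[of c] dist_mult_4_range[of c] by (auto simp: low_def)

lemma even_low: "even (low c f) \<longleftrightarrow> even c"
  by (simp add: low_def even_dist_mult_8 even_dist_mult_4)

text \<open>An even value keeps the residue of \<open>c\<close> modulo 4, so that it is either 2 or one of 0 and 4.
This distinguishes what a 3-chain can make of a position without 3-chains.\<close>
lemma low_mod_4: "even c \<Longrightarrow> low c f mod 4 = c mod 4"
proof -
  assume "even c"
  then have "c mod 4 = 0 \<or> c mod 4 = 2" by presburger
  then show ?thesis
    using \<open>even c\<close> by (auto simp: low_def dist_mult_8_mod_4 dist_mult_4_mod_4)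
qed

lemma low_0_to_4: "f \<ge> 1 \<Longrightarrow> 0 \<le> c \<Longrightarrow> c \<le> 4 \<Longrightarrow> low c f = c"
  by (simp add: low_def dist_mult_8_small)

lemma low_2_to_4: "f \<ge> 0 \<Longrightarrow> 2 \<le> c \<Longrightarrow> c \<le> 4 \<Longrightarrow> low c f = c"
  by (simp add: low_def dist_mult_8_small)

lemma low_5: "f \<ge> 0 \<Longrightarrow> low 5 f = 3"
  by (simp add: low_def dist_mult_def)

lemma low_odd: "c < 2 \<Longrightarrow> odd c \<Longrightarrow> low c 0 = 3"
proof -
  assume "c < 2" "odd c"
  have "c mod 4 = 1 \<or> c mod 4 = 3" using \<open>odd c\<close> by presburger
  then show ?thesis using \<open>c < 2\<close> by (auto simp: low_def dist_mult_def)
qed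

section \<open>The closed form in terms of counts\<close>

text \<open>The terminal bonus in terms of the numbers \<open>t\<close> of 3-chains, \<open>L\<close> of loops and \<open>m\<close> of longer chains.\<close>
definition bonus :: "int \<Rightarrow> int \<Rightarrow> int \<Rightarrow> int" where
  "bonus t L m = (if m > 0 then 4 else if t = 0 then (if L = 0 then 0 else 8) else if L = 0 then 4 else 6)"

text \<open>An extra loop changes the bonus only when it joins nothing or 3-chains alone.\<close>
lemma bonus_add_loop:
  "0 \<le> L \<Longrightarrow> 0 \<le> m \<Longrightarrow> \<not> (L = 0 \<and> m = 0) \<Longrightarrow> bonus t (L + 1) m = bonus t L m"
  by (auto simp: bonus_def)

lemma even_bonus: "even (bonus t L m)" by (simp add: bonus_def)

lemma bonus_4: "4 dvd bonus 0 L m" by (simp add: bonus_def)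

text \<open>Here \<open>t\<close> is the number of 3-chains and \<open>a\<close> is congruent modulo 4 to the number of boxes.
Opening a 3-chain turns a value \<open>w\<close> of the rest into \<open>1 + \<bar>w - 2\<bar>\<close>.  For \<open>0 \<le> w \<le> 4\<close> this
is 2 if \<open>w\<close> is odd, 1 if \<open>w = 2\<close>, and 3 if \<open>w\<close> is 0 or 4.  Tame positions are those where no 3-chain
brings the value down to 1 or 2: there is none, or the only one leaves a rest without 3-chains whose
number of boxes is divisible by 4, and then \<open>w\<close> is divisible by 4 as well (\<open>closed_form_mod_4\<close>).\<close>
definition tame :: "int \<Rightarrow> int \<Rightarrow> bool" where
  "tame t a \<longleftrightarrow> t = 0 \<or> t = 1 \<and> a mod 4 = 3"

lemma tame_0 [simp]: "tame 0 a" by (simp add: tame_def)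

text \<open>The claimed value as a function of five integers: the numbers \<open>t\<close> of 3-chains, \<open>f\<close> of 4-loops,
\<open>L\<close> of all loops and \<open>m\<close> of chains longer than 3, and the excess \<open>a\<close>, which is the controlled value
without the terminal bonus.  The excess is congruent to the number of boxes modulo 4.  The third
branch excludes the position \<open>4-loop + 3 + 3\<close>.\<close>
definition closed_form :: "int \<Rightarrow> int \<Rightarrow> int \<Rightarrow> int \<Rightarrow> int \<Rightarrow> int" where
  "closed_form t f L m a = (let c = a + bonus t L m in
     if t = 0 \<and> L = 0 \<and> m = 0 then 0
     else if c \<ge> 2 then c
     else if c = 0 \<and> f > 0 \<and> \<not> (t = 2 \<and> f = 1 \<and> L = 1 \<and> m = 0) then 0
     else if tame t a then low c f
     else if odd a then 1 else 2)"

text \<open>Constraints satisfied by the five numbers of a position.  A 3-chain contributes \<open>-1\<close> to the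
excess, a 4-loop \<open>-4\<close>, a 6-loop \<open>-2\<close>, and everything else at least 0, which gives the lower
bound.  Loops have even excess, so without longer chains the parity of \<open>a\<close> is that of \<open>t\<close>; and if
only 3-chains and 4-loops are present, then \<open>a\<close> is determined by their numbers.\<close>
definition feasible :: "int \<Rightarrow> int \<Rightarrow> int \<Rightarrow> int \<Rightarrow> int \<Rightarrow> bool" where
  "feasible t f L m a \<longleftrightarrow> t \<ge> 0 \<and> f \<ge> 0 \<and> f \<le> L \<and> m \<ge> 0 \<and> a \<ge> - t - 2*f - 2*L \<and>
    (m = 0 \<longrightarrow> even (a - t)) \<and> (m = 0 \<and> L = f \<longrightarrow> a = -t - 4*f)"

lemma feasible_empty: "feasible 0 f 0 0 a \<Longrightarrow> a = 0 \<and> f = 0" by (auto simp: feasible_def)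

lemma closed_form_ge_0: "closed_form t f L m a \<ge> 0"
  using low_range by (simp add: closed_form_def Let_def)

lemma closed_form_le: "a + bonus t L m \<le> 4 \<Longrightarrow> closed_form t f L m a \<le> 4"
  using low_range[of "a + bonus t L m" f] by (auto simp: closed_form_def Let_def)

lemma even_excess_add_bonus: "even (a + bonus t L m) \<longleftrightarrow> even a"
  using even_bonus[of t L m] by simp

text \<open>Every box goes to one of the players, so the margin has the parity of the number of boxes.  The
proofs below use this to exclude single values, typically the bottom of \<open>\<bar>w - 2\<bar>\<close> or \<open>\<bar>w - 4\<bar>\<close>.\<close>
lemma even_closed_form:
  assumes "feasible t f L m a"
  shows "even (closed_form t f L m a) \<longleftrightarrow> even a"
proof -
  define c where "c = a + bonus t L m"
  have "even c \<longleftrightarrow> even a" using even_excess_add_bonus by (simp add: c_def)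
  moreover have "t = 0 \<and> L = 0 \<and> m = 0 \<Longrightarrow> even a" using assms by (auto simp: feasible_def)
  moreover have "even (low c f) \<longleftrightarrow> even c" by (rule even_low)
  ultimately show ?thesis unfolding closed_form_def Let_def c_def[symmetric] by auto
qed

text \<open>The value is at least the controlled value: the controller may stay in control until the end.
Only \<open>c = 1\<close> needs an argument, where the value is odd and hence not 0.\<close>
lemma closed_form_ge:
  assumes "feasible t f L m a"
  shows "closed_form t f L m a \<ge> a + bonus t L m"
proof -
  define c where "c = a + bonus t L m"
  have "t = 0 \<and> L = 0 \<and> m = 0 \<Longrightarrow> c = 0" using assms by (auto simp: c_def feasible_def bonus_def)
  moreover have "c = 1 \<Longrightarrow> low c f \<noteq> 0" using even_low[of c f] by auto
  moreover have "0 \<le> low c f" by (rule low_range)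
  ultimately have "c < 2 \<Longrightarrow> c \<le> low c f" "t = 0 \<and> L = 0 \<and> m = 0 \<Longrightarrow> c = 0" by linarith+
  then show ?thesis unfolding closed_form_def Let_def c_def[symmetric] by auto
qed

text \<open>In the absence of 3-chains an even claimed value is congruent to the number of boxes modulo 4, so that
2 is separated from 0 and 4.\<close>
lemma closed_form_mod_4:
  assumes "feasible t f L m a" "t = 0" "even a"
  shows "closed_form t f L m a mod 4 = a mod 4"
proof -
  define c where "c = a + bonus t L m"
  have "c mod 4 = a mod 4" using bonus_4[of L m] \<open>t = 0\<close> by (auto simp: c_def elim!: dvdE)
  moreover have "even c" using \<open>even a\<close> even_excess_add_bonus[of a t L m] by (simp add: c_def)
  moreover have "low c f mod 4 = c mod 4" using low_mod_4[OF \<open>even c\<close>] .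
  moreover have "L = 0 \<and> m = 0 \<Longrightarrow> a = 0" using assms by (auto simp: feasible_def)
  moreover have "tame t a" using \<open>t = 0\<close> by (simp add: tame_def)
  ultimately show ?thesis
    unfolding closed_form_def Let_def c_def[symmetric] using \<open>t = 0\<close> by auto
qed

lemma closed_form_high: "\<not> (t = 0 \<and> L = 0 \<and> m = 0) \<Longrightarrow> a + bonus t L m \<ge> 2 \<Longrightarrow> closed_form t f L m a = a + bonus t L m"
  by (simp only: closed_form_def Let_def if_True if_False)

text \<open>For positions that are not tame: an upper bound that holds for \<open>c = 0\<close> too.\<close>
lemma closed_form_rough:
  assumes "\<not> tame t a" "a + bonus t L m < 2"
  shows "closed_form t f L m a \<le> (if odd a then 1 else 2)"
proof -
  have "t \<noteq> 0" using assms(1) by (auto simp: tame_def)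
  then show ?thesis unfolding closed_form_def Let_def using assms by simp
qed

lemma closed_form_rough_eq:
  assumes "\<not> tame t a" "a + bonus t L m < 2"
    and "a + bonus t L m \<noteq> 0 \<or> f \<le> 0 \<or> t = 2 \<and> f = 1 \<and> L = 1 \<and> m = 0"
  shows "closed_form t f L m a = (if odd a then 1 else 2)"
proof -
  define c where "c = a + bonus t L m"
  have "t \<noteq> 0" using assms(1) by (auto simp: tame_def)
  moreover have "c \<noteq> 0 \<or> f \<le> 0 \<or> t = 2 \<and> f = 1 \<and> L = 1 \<and> m = 0" using assms(3) by (simp add: c_def)
  moreover have "\<not> c \<ge> 2" using assms(2) by (simp add: c_def)
  ultimately show ?thesis unfolding closed_form_def Let_def c_def[symmetric] using assms(1) by force
qed

lemma closed_form_low_eq: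
  assumes "tame t a" "a + bonus t L m < 2" "\<not> (t = 0 \<and> L = 0 \<and> m = 0)"
    and "a + bonus t L m \<noteq> 0 \<or> f \<le> 0"
  shows "closed_form t f L m a = low (a + bonus t L m) f"
proof -
  define c where "c = a + bonus t L m"
  have "c \<noteq> 0 \<or> f \<le> 0" using assms(4) by (simp add: c_def)
  moreover have "\<not> c \<ge> 2" using assms(2) by (simp add: c_def)
  ultimately show ?thesis unfolding closed_form_def Let_def c_def[symmetric] using assms(1,3) by force
qed

lemma closed_form_zero:
  assumes "a + bonus t L m = 0" "f > 0" "\<not> (t = 2 \<and> f = 1 \<and> L = 1 \<and> m = 0)"
  shows "closed_form t f L m a = 0"
  unfolding closed_form_def Let_def using assms by simp

section \<open>No opening beats the closed form\<close>

text \<open>Opening a chain with \<open>N \<ge> 4\<close> boxes.  If the new controlled value is at least 2, staying in control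
suffices for the controller.  Otherwise the claimed value is at most 4, which the \<open>N - 2\<close> boxes
taken at once cover for \<open>N \<ge> 6\<close>.  For \<open>N = 5\<close> and \<open>N = 4\<close> parity excludes the bad values of \<open>w\<close>,
except when \<open>N = 4\<close> and the claimed value is 4.  That happens only without 3-chains, and then \<open>w\<close>
is divisible by 4.\<close>
lemma closed_form_le_opened_chain:
  assumes F: "feasible t f L m a" and "N \<ge> 4"
  shows "closed_form t f L (m + 1) (a + N - 4) \<le> N - 2 + \<bar>closed_form t f L m a - 2\<bar>"
proof (cases "t = 0 \<and> L = 0 \<and> m = 0")
  case True
  then have "a = 0" using F feasible_empty by blast
  then show ?thesis using True \<open>N \<ge> 4\<close> by (simp add: closed_form_def bonus_def)
next
  case False
  have "m \<ge> 0" using F by (simp add: feasible_def)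
  then have b: "bonus t L (m + 1) = 4" "bonus t L m \<ge> 4" using False by (auto simp: bonus_def)
  show ?thesis
  proof (cases "a + N \<ge> 2")
    case True
    then have "closed_form t f L (m + 1) (a + N - 4) = a + N"
      using b \<open>m \<ge> 0\<close> by (subst closed_form_high) auto
    then show ?thesis using closed_form_ge[OF F] b by linarith
  next
    case c: False
    let ?v = "closed_form t f L (m + 1) (a + N - 4)" and ?w = "closed_form t f L m a"
    have F': "feasible t f L (m + 1) (a + N - 4)" using F \<open>N \<ge> 4\<close> by (auto simp: feasible_def)
    have v4: "?v \<le> 4" using c b by (intro closed_form_le) simp
    have ev: "even ?v \<longleftrightarrow> even (a + N)" using even_closed_form[OF F'] by simp
    have ew: "even ?w \<longleftrightarrow> even a" using even_closed_form[OF F] .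
    consider "N \<ge> 6" | "N = 5" | "N = 4" "?v \<noteq> 4" | "N = 4" "?v = 4" using \<open>N \<ge> 4\<close> by linarith
    then show ?thesis
    proof cases
      case 1 then show ?thesis using v4 by linarith
    next
      case 2
      then have "?v = 4 \<Longrightarrow> ?w \<noteq> 2" using ev ew by auto
      then show ?thesis using v4 2 by linarith
    next
      case 3
      then have "?v = 3 \<Longrightarrow> ?w \<noteq> 2" using ev ew by auto
      then show ?thesis using v4 3 by linarith
    next
      case 4
      then have "even a" using ev by simp
      moreover have "tame t a"
      proof (rule ccontr)
        assume "\<not> tame t a"
        then have "?v \<le> 2" using closed_form_rough[of t "a + N - 4" L "m + 1" f] 4 c b by (auto split: if_splits)
        then show False using 4 by simp
      qed
      ultimately have "t = 0" using mod_4_3_odd unfolding tame_def by blast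
      then have "?w mod 4 = ?v mod 4" using closed_form_mod_4[OF F] closed_form_mod_4[OF F'] \<open>even a\<close> 4 by simp
      then have "?w mod 4 = 0" using 4 by simp
      then have "?w \<noteq> 1" "?w \<noteq> 2" "?w \<noteq> 3" by auto
      then show ?thesis using 4 by linarith
    qed
  qed
qed

text \<open>Below 2, this is what tameness was designed for: in a tame position the rest has a value divisible
by 4, so that the outcome is at least 3, and an odd value up to 4 is at most 3; in a position that is
not tame, parity is enough.\<close>
lemma closed_form_le_opened_3_chain:
  assumes F: "feasible t f L m a"
  shows "closed_form (t + 1) f L m (a - 1) \<le> 1 + \<bar>closed_form t f L m a - 2\<bar>"
proof (cases "t = 0 \<and> L = 0 \<and> m = 0")
  case True
  then have "a = 0" using F feasible_empty by blast
  then show ?thesis using True by (simp add: closed_form_def bonus_def)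
next
  case False
  let ?v = "closed_form (t + 1) f L m (a - 1)" and ?w = "closed_form t f L m a"
  have F': "feasible (t + 1) f L m (a - 1)" using F by (auto simp: feasible_def)
  have t: "t \<ge> 0" "m \<ge> 0" using F by (simp_all add: feasible_def)
  have b: "bonus (t + 1) L m \<le> bonus t L m" using False t by (auto simp: bonus_def)
  have ev: "even ?v \<longleftrightarrow> odd a" using even_closed_form[OF F'] by simp
  have ew: "even ?w \<longleftrightarrow> even a" using even_closed_form[OF F] .
  show ?thesis
  proof (cases "a - 1 + bonus (t + 1) L m \<ge> 2")
    case True
    then have "?v = a - 1 + bonus (t + 1) L m" using t by (subst closed_form_high) auto
    then show ?thesis using closed_form_ge[OF F] b by linarith
  next
    case c: False
    show ?thesis
    proof (cases "tame (t + 1) (a - 1)")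
      case True
      then have "t = 0" "(a - 1) mod 4 = 3" using t by (auto simp: tame_def)
      then have "a mod 4 = 0" using mod_4_pred by blast
      then have "even a" by presburger
      have "?w mod 4 = 0" using closed_form_mod_4[OF F] \<open>t = 0\<close> \<open>even a\<close> \<open>a mod 4 = 0\<close> by simp
      moreover have "?v \<le> 4" using c by (intro closed_form_le) simp
      moreover have "odd ?v" using ev \<open>even a\<close> by simp
      then have "?v \<noteq> 4" by auto
      moreover have "?w \<noteq> 1" "?w \<noteq> 2" "?w \<noteq> 3" using \<open>?w mod 4 = 0\<close> by auto
      ultimately show ?thesis by linarith
    next
      case False
      then have "?v \<le> (if odd (a - 1) then 1 else 2)" using c by (intro closed_form_rough) auto
      moreover have "?w \<noteq> 2" if "odd a" using ew that by auto
      ultimately show ?thesis by (cases "even a") auto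
    qed
  qed
qed

text \<open>In a tame position opening a 4-loop is exactly right, so this serves both bounds.  If neither side
has a controlled value of at least 2, it is the reflection property of \<open>low\<close>; the remaining cases
compare the zigzag with the identity on \<open>[2, 5]\<close>, where \<open>\<bar>w - 4\<bar>\<close> takes the values 2, 1, 0, 1.\<close>
lemma closed_form_eq_opened_4_loop:
  assumes F: "feasible t f L m a" and T: "tame t a"
  shows "closed_form t (f + 1) (L + 1) m (a - 4) = \<bar>closed_form t f L m a - 4\<bar>"
proof -
  have nn: "f \<ge> 0" "L \<ge> 0" "m \<ge> 0" "t \<noteq> 2" using F T by (auto simp: feasible_def tame_def)
  have "t = 0 \<or> t = 1" using T by (auto simp: tame_def)
  then consider (empty) "t = 0" "L = 0" "m = 0" | (single) "t = 1" "L = 0" "m = 0"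
    | (same) "\<not> (t = 0 \<and> L = 0 \<and> m = 0)" "bonus t (L + 1) m = bonus t L m"
    using nn bonus_add_loop[of L m t] by blast
  then show ?thesis
  proof cases
    case empty
    then have "a = 0" "f = 0" using F by (auto simp: feasible_def)
    then show ?thesis using empty by (simp add: closed_form_def bonus_def)
  next
    case single
    then have "a = -1" "f = 0" using F by (auto simp: feasible_def)
    then show ?thesis using single by (simp add: closed_form_def bonus_def low_def dist_mult_def tame_def)
  next
    case same
    define c where "c = a + bonus t L m"
    let ?v = "closed_form t (f + 1) (L + 1) m (a - 4)" and ?w = "closed_form t f L m a"
    have cG: "a - 4 + bonus t (L + 1) m = c - 4" using same by (simp add: c_def)
    have T': "tame t (a - 4)" using T by (auto simp: tame_def)
    have w: "c \<ge> 2 \<Longrightarrow> ?w = c" using same closed_form_high by (simp add: c_def)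
    have v: "c - 4 < 2 \<Longrightarrow> c - 4 \<noteq> 0 \<Longrightarrow> ?v = 4 - low c f"
      using closed_form_low_eq[OF T', of "L + 1" m "f + 1"] nn unfolding cG low_shift by simp
    consider "c \<ge> 6" | "c = 5" | "c = 4" | "2 \<le> c" "c < 4" | "c = 0" "f > 0" | "c < 2" "c \<noteq> 0 \<or> f = 0"
      using nn by linarith
    then show ?thesis
    proof cases
      case 1
      then have "?v = c - 4" using closed_form_high[of t "L + 1" m "a - 4"] cG nn by simp
      then show ?thesis using 1 w by simp
    next
      case 2 then show ?thesis using v w low_5 nn by simp
    next
      case 3
      then have "?v = 0" using closed_form_zero[of "a - 4" t "L + 1" m] cG nn by simp
      then show ?thesis using 3 w by simp
    next
      case 4 then show ?thesis using v w low_2_to_4 nn by simp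
    next
      case 5
      then have "?w = 0" using closed_form_zero nn by (simp add: c_def)
      then show ?thesis using 5 v low_0_to_4[of f 0] by simp
    next
      case 6
      then have "?w = low c f" using closed_form_low_eq[OF T] same by (simp add: c_def)
      then show ?thesis using 6 v low_range[of c f] by simp
    qed
  qed
qed

text \<open>If the position is not tame and its controlled value is below 2, its claimed value is at most 1 or
2, according to parity, so \<open>\<bar>w - 4\<bar>\<close> could be smaller only for \<open>w = 4\<close>.  But \<open>w = 4\<close> forces
controlled value 4 for the rest, hence 0 after adding the 4-loop, where the claimed value is 0.\<close>
lemma closed_form_le_opened_4_loop:
  assumes F: "feasible t f L m a"
  shows "closed_form t (f + 1) (L + 1) m (a - 4) \<le> \<bar>closed_form t f L m a - 4\<bar>"
proof (cases "tame t a")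
  case True
  then show ?thesis using closed_form_eq_opened_4_loop[OF F] by simp
next
  case nt: False
  let ?v = "closed_form t (f + 1) (L + 1) m (a - 4)" and ?w = "closed_form t f L m a"
  have nn: "f \<ge> 0" "L \<ge> 0" "m \<ge> 0" "t > 0" using F nt by (auto simp: feasible_def tame_def less_le)
  have nt': "\<not> tame t (a - 4)" using nt by (auto simp: tame_def)
  have ew: "even ?w \<longleftrightarrow> even a" using even_closed_form[OF F] .
  consider (only3) "L = 0" "m = 0" "f = 0" "a = - t" "bonus t (L + 1) m = 6" "bonus t L m = 4"
    | (same) "L > 0 \<or> m > 0" "bonus t (L + 1) m = bonus t L m"
  proof (cases "L = 0 \<and> m = 0")
    case True
    moreover from this have "f = 0" "a = - t" using F by (auto simp: feasible_def)
    ultimately show thesis using only3 nn by (simp add: bonus_def)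
  next
    case False
    then show thesis using same bonus_add_loop nn by fastforce
  qed
  then have c: "a - 4 + bonus t (L + 1) m < 2 \<or> bonus t (L + 1) m = bonus t L m"
    and c4: "a + bonus t L m = 4 \<Longrightarrow> bonus t (L + 1) m = bonus t L m \<and> (L > 0 \<or> m > 0)"
    using nn by (cases; simp)+
  show ?thesis
  proof (cases "a - 4 + bonus t (L + 1) m \<ge> 2")
    case True
    then have "?v = a - 4 + bonus t (L + 1) m" using nn by (subst closed_form_high) auto
    then show ?thesis using closed_form_ge[OF F] c True by linarith
  next
    case below: False
    then have v: "?v \<le> (if odd a then 1 else 2)" using closed_form_rough[OF nt', of "L + 1" m "f + 1"] by simp
    show ?thesis
    proof (cases "odd a")
      case True
      then have "?w \<noteq> 4" using ew by auto
      then show ?thesis using v True by simp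
    next
      case False
      then have "?w \<noteq> 3" "?w \<noteq> 5" using ew by auto
      moreover have "?v \<le> 0" if "?w = 4"
      proof -
        have "a + bonus t L m \<ge> 2" using that closed_form_rough[OF nt, of L m f] False by force
        then have "a + bonus t L m = 4" using that closed_form_high[of t L m a f] nn by simp
        then show ?thesis using c4 closed_form_zero[of "a - 4" t "L + 1" m "f + 1"] nn by auto
      qed
      moreover have "?v \<le> 2" using v False by simp
      ultimately show ?thesis by (cases "?w = 4") (simp, linarith)
    qed
  qed
qed

text \<open>As for chains: staying in control settles a controlled value of at least 2, except that a first loop
among 3-chains raises the bonus by 2, where a single 3-chain needs its exact value 3.  Below 2 the
claimed value is at most 4, which loops of length 8 or more cover at once.  For length 6, parity
settles value 3, and value 4 occurs only without 3-chains, where residues modulo 4 force \<open>w\<close> to be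
congruent to 2.\<close>
lemma closed_form_le_opened_loop:
  assumes F: "feasible t f L m a" and N: "N \<ge> 6" "even N"
  shows "closed_form t f (L + 1) m (a + N - 8) \<le> N - 4 + \<bar>closed_form t f L m a - 4\<bar>"
proof -
  let ?v = "closed_form t f (L + 1) m (a + N - 8)" and ?w = "closed_form t f L m a"
  have nn: "f \<ge> 0" "L \<ge> 0" "m \<ge> 0" "t \<ge> 0" using F by (auto simp: feasible_def)
  have F': "feasible t f (L + 1) m (a + N - 8)" using F N by (auto simp: feasible_def)
  have ev: "even ?v \<longleftrightarrow> even a" using even_closed_form[OF F'] N by simp
  have ew: "even ?w \<longleftrightarrow> even a" using even_closed_form[OF F] .
  show ?thesis
  proof (cases "a + N - 8 + bonus t (L + 1) m \<ge> 2")
    case True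
    then have v: "?v = a + N - 8 + bonus t (L + 1) m" using nn by (subst closed_form_high) auto
    consider (empty) "t = 0" "L = 0" "m = 0" | (only3) "t > 0" "L = 0" "m = 0"
      | (same) "bonus t (L + 1) m = bonus t L m"
      using nn bonus_add_loop[of L m t] by fastforce
    then show ?thesis
    proof cases
      case empty
      then have "a = 0" using F by (auto simp: feasible_def)
      then show ?thesis using v empty by (simp add: closed_form_def bonus_def)
    next
      case only3
      then have "a = - t" "f = 0" using F by (auto simp: feasible_def)
      then have *: "?v = N - 2 - t" using v only3 by (simp add: bonus_def)
      show ?thesis
      proof (cases "t = 1")
        case True
        then have "?w = 3" using only3 \<open>a = - t\<close> \<open>f = 0\<close> by (simp add: closed_form_def bonus_def)
        then show ?thesis using * True by simp
      next
        case False
        then show ?thesis using * only3 by simp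
      qed
    next
      case same
      then show ?thesis using v closed_form_ge[OF F] by linarith
    qed
  next
    case below: False
    then have v4: "?v \<le> 4" by (intro closed_form_le) simp
    have "N = 6 \<or> N \<ge> 8" using N by presburger
    then consider "N \<ge> 8" | "?v \<le> 2" | "N = 6" "?v = 3" | "N = 6" "?v = 4" using v4 by linarith
    then show ?thesis
    proof cases
      case 1 then show ?thesis using v4 by linarith
    next
      case 2 then show ?thesis using N by linarith
    next
      case 3
      then have "?w \<noteq> 4" using ev ew by auto
      then show ?thesis using 3 by linarith
    next
      case 4
      then have "even a" using ev by simp
      have "tame t (a + N - 8)"
      proof (rule ccontr)
        assume "\<not> tame t (a + N - 8)"
        then show False using closed_form_rough[of t "a + N - 8" "L + 1" m f] below 4 by (auto split: if_splits)
      qed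
      then have "t = 0" using \<open>even a\<close> 4 mod_4_3_odd[of "a + N - 8"] by (auto simp: tame_def)
      then have "?v mod 4 = (a - 2) mod 4" "?w mod 4 = a mod 4"
        using closed_form_mod_4[OF F] closed_form_mod_4[OF F'] \<open>even a\<close> 4 by auto
      moreover have "(a - 2) mod 4 = 0 \<Longrightarrow> a mod 4 \<noteq> 0" by presburger
      ultimately have "?w \<noteq> 4" using 4 by auto
      moreover have "?w \<noteq> 3" "?w \<noteq> 5" using ew \<open>even a\<close> by auto
      ultimately show ?thesis using 4 by linarith
    qed
  qed
qed

section \<open>Openings that attain the closed form\<close>

text \<open>With chains of length at least 4 only, the opener cannot do better than let the controller keep
control throughout.\<close>
lemma opened_chain_le_closed_form:
  assumes F: "feasible 0 0 0 m a" and "N \<ge> 4" "a \<ge> 0"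
  shows "N - 2 + \<bar>closed_form 0 0 0 m a - 2\<bar> \<le> closed_form 0 0 0 (m + 1) (a + N - 4)"
proof -
  have "m \<ge> 0" using F by (simp add: feasible_def)
  then have v: "closed_form 0 0 0 (m + 1) (a + N - 4) = a + N"
    using assms by (subst closed_form_high) (auto simp: bonus_def)
  show ?thesis
  proof (cases "m = 0")
    case True
    then have "a = 0" using F by (simp add: feasible_def)
    then show ?thesis using v True by (simp add: closed_form_def)
  next
    case False
    then have "closed_form 0 0 0 m a = a + 4"
      using assms \<open>m \<ge> 0\<close> by (subst closed_form_high) (auto simp: bonus_def)
    then show ?thesis using v assms by simp
  qed
qed

text \<open>Without 3-chains and 4-loops the opener opens a shortest loop.  If it has length 8 or more, then no
component has negative excess and a nonempty rest has controlled value at least 4, so control is kept.  A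
6-loop reflects the value at 3, which is the identity
\<open>4 - dist_mult 4 (c - 2) = 6 - (4 - dist_mult 4 c)\<close>.\<close>
lemma opened_loop_le_closed_form:
  assumes F: "feasible 0 0 L m a" and N: "N = 6 \<or> N \<ge> 6 \<and> a \<ge> 0"
  shows "N - 4 + \<bar>closed_form 0 0 L m a - 4\<bar> \<le> closed_form 0 0 (L + 1) m (a + N - 8)"
proof (cases "L = 0 \<and> m = 0")
  case True
  then have "a = 0" using F by (auto simp: feasible_def)
  moreover have "closed_form 0 0 (L + 1) m (a + N - 8) = N"
    using True \<open>a = 0\<close> N by (subst closed_form_high) (auto simp: bonus_def)
  ultimately show ?thesis using True by (simp add: closed_form_def)
next
  case False
  have nn: "L \<ge> 0" "m \<ge> 0" using F by (auto simp: feasible_def)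
  define c where "c = a + bonus 0 L m"
  let ?v = "closed_form 0 0 (L + 1) m (a + N - 8)" and ?w = "closed_form 0 0 L m a"
  have cG: "a + N - 8 + bonus 0 (L + 1) m = c + N - 8"
    using bonus_add_loop[of L m 0] False nn by (simp add: c_def)
  have "bonus 0 L m \<ge> 4" using False nn by (auto simp: bonus_def)
  have w: "c \<ge> 2 \<Longrightarrow> ?w = c" using False closed_form_high by (simp add: c_def)
  show ?thesis
  proof (cases "c \<ge> 4")
    case True
    then have "?v = c + N - 8" using closed_form_high[of 0 "L + 1" m "a + N - 8"] cG nn N by auto
    then show ?thesis using w True by simp
  next
    case lt4: False
    then have "N = 6" using N \<open>bonus 0 L m \<ge> 4\<close> by (auto simp: c_def)
    have "?v = low (c - 2) 0"
      using closed_form_low_eq[of 0 "a + N - 8" "L + 1" m 0] lt4 nn \<open>N = 6\<close> unfolding cG by simp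
    then have v: "?v = 2 + dist_mult 4 c"
      using lt4 by (simp add: low_def dist_mult_4_shift_2)
    consider "c = 2" | "c = 3" | "c < 2" using lt4 by linarith
    then show ?thesis
    proof cases
      case 3
      then have "?w = 4 - dist_mult 4 c" using closed_form_low_eq[of 0 a L m 0] False by (simp add: c_def low_def)
      then show ?thesis using v \<open>N = 6\<close> dist_mult_4_range[of c] by simp
    qed (use v w \<open>N = 6\<close> in \<open>simp_all add: dist_mult_def\<close>)
  qed
qed

text \<open>A single 3-chain together with loops: opening the 3-chain would raise the bonus from 6 to 8, so the
opener keeps it and opens a shortest loop.\<close>
lemma opened_loop_le_closed_form_single_3_chain:
  assumes F: "feasible 1 0 L 0 a" and N: "N = 6 \<or> N \<ge> 6 \<and> a \<ge> -1"
    and c: "a + N - 8 + bonus 1 (L + 1) 0 \<ge> 2"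
  shows "N - 4 + \<bar>closed_form 1 0 L 0 a - 4\<bar> \<le> closed_form 1 0 (L + 1) 0 (a + N - 8)"
proof -
  have "L \<ge> 0" "odd a" using F by (auto simp: feasible_def)
  then have v: "closed_form 1 0 (L + 1) 0 (a + N - 8) = a + N - 2"
    using c by (subst closed_form_high) (auto simp: bonus_def)
  show ?thesis
  proof (cases "L = 0")
    case True
    then have "a = -1" using F by (auto simp: feasible_def)
    then show ?thesis using True v by (simp add: closed_form_def bonus_def)
  next
    case False
    then have b: "bonus 1 L 0 = 6" by (simp add: bonus_def)
    have "a + N - 2 \<ge> 2" using c \<open>L \<ge> 0\<close> by (simp add: bonus_def)
    then have "a \<ge> -2" using N by auto
    then have "a \<ge> -1" using \<open>odd a\<close> by (cases "a = -2") auto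
    then have "closed_form 1 0 L 0 a = a + 6" using b by (subst closed_form_high) auto
    then show ?thesis using v \<open>a \<ge> -1\<close> by simp
  qed
qed

text \<open>If the rest has controlled value at least 3, opening a 4-loop is optimal whether or not the position
is tame: the rest then has its controlled value \<open>c\<close> as value, and \<open>\<bar>c - 4\<bar>\<close> is \<open>c - 4\<close>, or 1 for
\<open>c = 3\<close>, where parity makes the claimed value at least 1.\<close>
lemma opened_4_loop_le_closed_form:
  assumes F: "feasible t f L m a" and ne: "\<not> (L = 0 \<and> m = 0)"
    and c: "a - 4 + bonus t (L + 1) m \<ge> -1"
  shows "\<bar>closed_form t f L m a - 4\<bar> \<le> closed_form t (f + 1) (L + 1) m (a - 4)"
proof -
  have nn: "L \<ge> 0" "m \<ge> 0" "t \<ge> 0" "f \<ge> 0" using F by (auto simp: feasible_def)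
  define c where "c = a + bonus t L m"
  have cG: "a - 4 + bonus t (L + 1) m = c - 4"
    using bonus_add_loop[of L m t] ne nn by (simp add: c_def)
  have F': "feasible t (f + 1) (L + 1) m (a - 4)" using F by (auto simp: feasible_def)
  have w: "closed_form t f L m a = c" using ne c cG by (subst closed_form_high) (auto simp: c_def)
  have v: "closed_form t (f + 1) (L + 1) m (a - 4) \<ge> c - 4" "closed_form t (f + 1) (L + 1) m (a - 4) \<ge> 0"
    using closed_form_ge[OF F'] cG closed_form_ge_0 by simp_all
  show ?thesis
  proof (cases "c = 3")
    case True
    then have "odd a" using even_excess_add_bonus[of a t L m] by (simp add: c_def)
    then have "odd (closed_form t (f + 1) (L + 1) m (a - 4))" using even_closed_form[OF F'] by simp
    then have "closed_form t (f + 1) (L + 1) m (a - 4) \<noteq> 0" by auto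
    then show ?thesis using w v True by simp
  next
    case False
    then show ?thesis using w v c cG by auto
  qed
qed

text \<open>In all remaining cases a 3-chain is opened.  The assumptions list the exceptions, in terms of the
rest: the position is tame with a 4-loop; there is a 4-loop covered by the previous lemma; the only
3-chain is accompanied by nothing but loops and has to be kept for its bonus.

If the controlled value is at least 2, control is kept.  Otherwise \<open>0 \<le> w \<le> 4\<close>.  For an odd rest
\<open>w\<close> is 1 or 3, the outcome is 2, and so is the claimed value.  For an even rest \<open>w = 2\<close> yields 1, the
least odd value.  The other even values occur only for rests without 3-chains and with \<open>a\<close> divisible
by 4, and then the position is tame without 4-loops, with claimed value 3.\<close>
lemma opened_3_chain_le_closed_form:
  assumes F: "feasible t f L m a"
    and one: "\<not> (t = 0 \<and> a mod 4 = 0 \<and> f > 0)"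
    and two: "\<not> (f > 0 \<and> L + m > 1 \<and> a - 1 + bonus (t + 1) L m \<ge> -1)"
    and three: "\<not> (t = 0 \<and> m = 0 \<and> L > 0 \<and> a - 1 + bonus (t + 1) L m \<ge> 2)"
  shows "1 + \<bar>closed_form t f L m a - 2\<bar> \<le> closed_form (t + 1) f L m (a - 1)"
proof (cases "t = 0 \<and> L = 0 \<and> m = 0")
  case True
  then have "a = 0" using F by (auto simp: feasible_def)
  then show ?thesis using True by (simp add: closed_form_def bonus_def)
next
  case ne: False
  let ?v = "closed_form (t + 1) f L m (a - 1)" and ?w = "closed_form t f L m a"
  have nn: "L \<ge> 0" "m \<ge> 0" "t \<ge> 0" "f \<ge> 0" "f \<le> L" using F by (auto simp: feasible_def)
  have F': "feasible (t + 1) f L m (a - 1)" using F by (auto simp: feasible_def)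
  define c where "c = a - 1 + bonus (t + 1) L m"
  have ev: "even ?v \<longleftrightarrow> odd a" using even_closed_form[OF F'] by simp
  have ew: "even ?w \<longleftrightarrow> even a" using even_closed_form[OF F] .
  have ec: "even c \<longleftrightarrow> odd a" using even_excess_add_bonus[of "a - 1" "t + 1" L m] by (simp add: c_def)
  have pos: "?w \<ge> 0" "?v \<ge> 0" using closed_form_ge_0 by auto
  have b: "bonus t L m = bonus (t + 1) L m" if "t > 0 \<or> m > 0" using that nn by (auto simp: bonus_def)
  show ?thesis
  proof (cases "c \<ge> 2")
    case True
    \<comment> \<open>The bonus would differ only for a single 3-chain among loops, which is the third exception.\<close>
    have b': "a + bonus t L m = c + 1" using b three nn ne True by (fastforce simp: c_def)
    then have "?w = c + 1" using closed_form_high[OF ne] True by simp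
    moreover have "?v = c" using True nn closed_form_high[of "t + 1" L m "a - 1"] by (simp add: c_def)
    ultimately show ?thesis using True by simp
  next
    case c2: False
    have w4: "?w \<le> 4"
    proof (cases "t > 0 \<or> m > 0")
      case True
      then show ?thesis using b c2 by (intro closed_form_le) (simp add: c_def)
    next
      case False
      then have *: "t = 0" "m = 0" "bonus t L m = 8" "bonus (t + 1) L m = 6" "even a"
        using ne nn F by (auto simp: bonus_def feasible_def)
      then show ?thesis using c2 by (intro closed_form_le) (simp add: c_def)
    qed
    have v: "?v = (if odd a then 2 else 1)"
      if "\<not> tame (t + 1) (a - 1)" "c \<noteq> 0 \<or> f \<le> 0 \<or> t = 1 \<and> f = 1 \<and> L = 1 \<and> m = 0"
      using closed_form_rough_eq[of "t + 1" "a - 1" L m f] that c2 by (auto simp: c_def)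
    show ?thesis
    proof (cases "odd a")
      case True
      then have nt: "\<not> tame (t + 1) (a - 1)" using nn mod_4_3_odd[of "a - 1"] by (auto simp: tame_def)
      \<comment> \<open>With controlled value 0 and a 4-loop, the exceptions leave only \<open>4-loop + 3 + 3\<close>.\<close>
      have "c \<noteq> 0 \<or> f \<le> 0 \<or> t = 1 \<and> f = 1 \<and> L = 1 \<and> m = 0"
      proof (cases "c = 0 \<and> f > 0")
        case *: True
        then have "L + m \<le> 1" using two by (auto simp: c_def)
        then have "f = 1" "L = 1" "m = 0" using * nn by auto
        moreover from this have "a = - t - 4" "bonus (t + 1) L m = 6" using F nn by (auto simp: feasible_def bonus_def)
        ultimately show ?thesis using * by (simp add: c_def)
      qed auto
      then have "?v = 2" using v[OF nt] True by simp
      moreover have "?w \<noteq> 0" "?w \<noteq> 2" "?w \<noteq> 4" using ew True by auto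
      ultimately show ?thesis using pos w4 by linarith
    next
      case False
      then have v1: "?v \<ge> 1" using ev pos by (cases "?v = 0") auto
      have "?w \<noteq> 1" "?w \<noteq> 3" using ew False by auto
      show ?thesis
      proof (cases "?w = 2")
        case True
        then show ?thesis using v1 by simp
      next
        case w2: False
        have "?v \<ge> 3"
        proof (cases "t = 0")
          case True
          then have "?w mod 4 = a mod 4" using closed_form_mod_4[OF F] False by simp
          moreover have "?w = 0 \<or> ?w = 4" using w4 pos w2 \<open>?w \<noteq> 1\<close> \<open>?w \<noteq> 3\<close> by linarith
          ultimately have a: "a mod 4 = 0" by auto
          then have "f = 0" using one nn True by simp
          moreover have "tame (t + 1) (a - 1)" using a True mod_4_pred by (simp add: tame_def)
          ultimately have "?v = low c 0" using closed_form_low_eq[of "t + 1" "a - 1" L m f] c2 nn by (simp add: c_def)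
          then show ?thesis using low_odd[of c] c2 ec False by simp
        next
          case t: False
          then have nt: "\<not> tame t a" using nn False mod_4_3_odd[of a] by (auto simp: tame_def)
          have cw: "a + bonus t L m = c + 1" using b t nn by (simp add: c_def)
          have "?w = 2"
          proof (cases "c = 1")
            case True
            then show ?thesis using closed_form_high[OF ne] cw by simp
          next
            case c1: False
            \<comment> \<open>Likewise, a rest with controlled value 0 and a 4-loop is \<open>4-loop + 3 + 3\<close>.\<close>
            have "c + 1 \<noteq> 0 \<or> f \<le> 0 \<or> t = 2 \<and> f = 1 \<and> L = 1 \<and> m = 0"
            proof (cases "c = -1 \<and> f > 0")
              case *: True
              then have "L + m \<le> 1" using two by (auto simp: c_def)
              then have "f = 1" "L = 1" "m = 0" using * nn by auto
              moreover from this have "a = - t - 4" "bonus (t + 1) L m = 6" using F nn by (auto simp: feasible_def bonus_def)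
              ultimately show ?thesis using * by (simp add: c_def)
            qed auto
            then show ?thesis using closed_form_rough_eq[OF nt, of L m f] cw c1 c2 False by simp
          qed
          then show ?thesis using w2 by simp
        qed
        then show ?thesis using pos w4 by linarith
      qed
    qed
  qed
qed

section \<open>Positions\<close>

text \<open>The controller's margin if he makes the sacrifice in every component.  The terminal bonus accounts
for the end of the play, where no sacrifice is needed.\<close>
definition excess :: "component multiset \<Rightarrow> int" where
  "excess G = (\<Sum>C\<in>#G. int (len C) - 2 * int (sacrifice C))"

abbreviation three_chains :: "component multiset \<Rightarrow> int" where
  "three_chains G \<equiv> int (count G (Chain 3))"

abbreviation four_loops :: "component multiset \<Rightarrow> int" where
  "four_loops G \<equiv> int (count G (Loop 4))"

abbreviation loops :: "component multiset \<Rightarrow> int" where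
  "loops G \<equiv> int (size (filter_mset is_loop G))"

abbreviation longer_chains :: "component multiset \<Rightarrow> int" where
  "longer_chains G \<equiv> int (size (filter_mset (\<lambda>C. is_chain C \<and> C \<noteq> Chain 3) G))"

definition predicted :: "component multiset \<Rightarrow> int" where
  "predicted G = closed_form (three_chains G) (four_loops G) (loops G) (longer_chains G) (excess G)"

lemma valid_component_cases:
  assumes "valid_component C"
  obtains "C = Chain 3" | n where "C = Chain n" "n \<ge> 4"
    | "C = Loop 4" | n where "C = Loop n" "n \<ge> 6" "even n"
proof (cases C)
  case (Chain n)
  then have "n = 3 \<or> n \<ge> 4" using assms by auto
  then show thesis using Chain that by blast
next
  case (Loop n)
  then have "even n" "n = 4 \<or> n \<ge> 6" using assms by (auto elim!: evenE)
  then show thesis using Loop that by blast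
qed

lemma position_add: "position (add_mset C R) \<longleftrightarrow> valid_component C \<and> position R"
  by (auto simp: position_def)

lemma excess_simps [simp]: "excess {#} = 0"
  "excess (add_mset C R) = int (len C) - 2 * int (sacrifice C) + excess R"
  by (simp_all add: excess_def)

lemma feasible_position: "position G \<Longrightarrow> feasible (three_chains G) (four_loops G) (loops G) (longer_chains G) (excess G)"
proof (induction G)
  case empty
  then show ?case by (simp add: feasible_def)
next
  case (add C R)
  then have "valid_component C"
    and F: "feasible (three_chains R) (four_loops R) (loops R) (longer_chains R) (excess R)"
    by (auto simp: position_add)
  from this(1) show ?case
    by (cases rule: valid_component_cases) (use F in \<open>auto simp: feasible_def\<close>)
qed

text \<open>Only 3-chains, 4-loops and 6-loops have negative excess.\<close>
lemma excess_ge: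
  "position G \<Longrightarrow> Loop 4 \<notin># G \<Longrightarrow> Loop 6 \<notin># G \<Longrightarrow> excess G \<ge> - three_chains G"
proof (induction G)
  case (add C R)
  then have "valid_component C" "excess R \<ge> - three_chains R" "C \<noteq> Loop 4" "C \<noteq> Loop 6"
    by (auto simp: position_add)
  from this(1) show ?case
  proof (cases rule: valid_component_cases)
    case (4 n)
    then have "n \<ge> 8" using \<open>C \<noteq> Loop 6\<close> by (auto elim!: evenE)
    then show ?thesis using 4 \<open>excess R \<ge> - three_chains R\<close> by simp
  qed (use add \<open>excess R \<ge> - three_chains R\<close> \<open>C \<noteq> Loop 4\<close> in auto)
qed simp

text \<open>The controller's choice written with an absolute value, so that staying in control or not is the
sign of \<open>w - k\<close>.\<close>
lemma opened_value_alt: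
  "opened_value (Chain n) w = int n - 2 + \<bar>w - 2\<bar>"
  "opened_value (Loop n) w = int n - 4 + \<bar>w - 4\<bar>"
  by (auto simp: opened_value_def)

lemma predicted_add:
  "predicted (add_mset (Chain 3) R) =
     closed_form (three_chains R + 1) (four_loops R) (loops R) (longer_chains R) (excess R - 1)"
  "n \<noteq> 3 \<Longrightarrow> predicted (add_mset (Chain n) R) =
     closed_form (three_chains R) (four_loops R) (loops R) (longer_chains R + 1) (excess R + int n - 4)"
  "predicted (add_mset (Loop 4) R) =
     closed_form (three_chains R) (four_loops R + 1) (loops R + 1) (longer_chains R) (excess R - 4)"
  "n \<noteq> 4 \<Longrightarrow> predicted (add_mset (Loop n) R) =
     closed_form (three_chains R) (four_loops R) (loops R + 1) (longer_chains R) (excess R + int n - 8)"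
  by (simp_all add: predicted_def algebra_simps)

section \<open>The recursion for the value\<close>

lemma predicted_le_opened_value:
  assumes "position (add_mset C R)"
  shows "predicted (add_mset C R) \<le> opened_value C (predicted R)"
proof -
  have "valid_component C"
    and F: "feasible (three_chains R) (four_loops R) (loops R) (longer_chains R) (excess R)"
    using assms feasible_position by (auto simp: position_add)
  from this(1) show ?thesis
  proof (cases rule: valid_component_cases)
    case 1
    then show ?thesis using closed_form_le_opened_3_chain[OF F] by (simp add: predicted_add opened_value_alt flip: predicted_def)
  next
    case (2 n)
    then show ?thesis using closed_form_le_opened_chain[OF F, of "int n"] by (simp add: predicted_add opened_value_alt flip: predicted_def)
  next
    case 3
    then show ?thesis using closed_form_le_opened_4_loop[OF F] by (simp add: predicted_add opened_value_alt flip: predicted_def)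
  next
    case (4 n)
    then show ?thesis using closed_form_le_opened_loop[OF F, of "int n"] by (simp add: predicted_add opened_value_alt flip: predicted_def)
  qed
qed

text \<open>The opener attains the prediction by the following rule.  With chains of length at least 4 only, open
any.  With a 4-loop, open it if the position is tame, or if the controlled value is at least \<open>-1\<close>
and there is something besides this 4-loop and the 3-chains.  Without 4-loops, open a shortest loop
if there are no 3-chains, or if a single 3-chain is accompanied by loops alone and the controlled
value is at least 2.  In all other cases open a 3-chain.\<close>
lemma ex_optimal_opening:
  assumes G: "position G" "G \<noteq> {#}"
  shows "\<exists>C R. G = add_mset C R \<and> opened_value C (predicted R) \<le> predicted G"
proof -
  let ?t = "three_chains G" and ?f = "four_loops G" and ?L = "loops G" and ?m = "longer_chains G"
  define c where "c = excess G + bonus ?t ?L ?m"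
  have FG: "feasible ?t ?f ?L ?m (excess G)" using feasible_position[OF G(1)] .
  have rest: "position R"
    "feasible (three_chains R) (four_loops R) (loops R) (longer_chains R) (excess R)"
    if "G = add_mset C R" for C R
    using that G(1) feasible_position[of R] by (auto simp: position_add)
  consider (chains) "?t = 0" "?L = 0"
    | (four) "?f > 0" "tame ?t (excess G) \<or> c \<ge> -1 \<and> ?L + ?m > 1"
    | (loop) "?f = 0" "?L > 0" "?t = 0 \<or> ?t = 1 \<and> ?m = 0 \<and> c \<ge> 2"
    | (three) "?t > 0" "?f > 0 \<Longrightarrow> \<not> tame ?t (excess G)" "?f > 0 \<Longrightarrow> \<not> (c \<ge> -1 \<and> ?L + ?m > 1)"
         "\<not> (?f = 0 \<and> ?L > 0 \<and> ?t = 1 \<and> ?m = 0 \<and> c \<ge> 2)"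
  proof -
    have "?t \<ge> 0" "?f \<ge> 0" "?L \<ge> 0" "?t = 0 \<Longrightarrow> tame ?t (excess G)" "?f \<le> ?L"
      using FG by (auto simp: feasible_def)
    then show thesis using chains four loop three by (smt (verit))
  qed
  then show ?thesis
  proof cases
    case chains
    obtain C R where CR: "G = add_mset C R" using G(2) by (cases G) auto
    have "valid_component C" using CR G(1) by (simp add: position_add)
    then obtain n where n: "C = Chain n" "n \<ge> 4"
      by (cases rule: valid_component_cases) (use chains CR in auto)
    have R: "three_chains R = 0" "loops R = 0" using chains CR n by auto
    have "Loop k \<notin># R" for k using R(2) by auto
    then have "excess R \<ge> 0" "four_loops R = 0"
      using excess_ge[OF rest(1)[OF CR]] R(1) by (auto simp: not_in_iff)
    moreover have "predicted R = closed_form 0 0 0 (longer_chains R) (excess R)"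
      unfolding predicted_def R \<open>four_loops R = 0\<close> ..
    moreover have "predicted G = closed_form 0 0 0 (longer_chains R + 1) (excess R + int n - 4)"
      using n by (simp only: CR predicted_add R \<open>four_loops R = 0\<close>)
    moreover have "feasible 0 0 0 (longer_chains R) (excess R)"
      using rest(2)[OF CR] unfolding R \<open>four_loops R = 0\<close> .
    ultimately have "opened_value C (predicted R) \<le> predicted G"
      using opened_chain_le_closed_form[of "longer_chains R" "excess R" "int n"] n by (simp only: opened_value_alt)
    then show ?thesis using CR by blast
  next
    case four
    then have "Loop 4 \<in># G" by (cases "Loop 4 \<in># G") (simp_all add: not_in_iff)
    then obtain R where CR: "G = add_mset (Loop 4) R" by (auto dest!: multi_member_split)
    note F = rest(2)[OF CR]
    have "\<bar>predicted R - 4\<bar> \<le> predicted G"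
    proof (cases "tame ?t (excess G)")
      case True
      then have "tame (three_chains R) (excess R)" using CR by (auto simp: tame_def)
      then show ?thesis using closed_form_eq_opened_4_loop[OF F] CR by (simp add: predicted_add flip: predicted_def)
    next
      case False
      then have "c \<ge> -1" "?L + ?m > 1" using four by auto
      have R: "?t = three_chains R" "?m = longer_chains R" "?L = loops R + 1"
        "excess G = excess R - 4"
        using CR by auto
      have "\<not> (loops R = 0 \<and> longer_chains R = 0)" using \<open>?L + ?m > 1\<close> R by linarith
      moreover have "c = excess R - 4 + bonus (three_chains R) (loops R + 1) (longer_chains R)"
        unfolding c_def R ..
      then have "excess R - 4 + bonus (three_chains R) (loops R + 1) (longer_chains R) \<ge> -1"
        using \<open>c \<ge> -1\<close> by simp
      ultimately show ?thesis
        unfolding CR predicted_add by (intro opened_4_loop_le_closed_form[OF F, folded predicted_def])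
    qed
    then show ?thesis
      using CR by (intro exI[of _ "Loop 4"] exI[of _ R]) (simp add: opened_value_alt)
  next
    case loop
    have no4: "Loop 4 \<notin># G" using loop by (simp add: not_in_iff)
    \<comment> \<open>It suffices to prefer a 6-loop: without one, the choice of the loop does not matter.\<close>
    obtain n where n: "Loop n \<in># G" "n \<ge> 6" "n = 6 \<or> Loop 6 \<notin># G"
    proof (cases "Loop 6 \<in># G")
      case True
      then show thesis using that by simp
    next
      case False
      have "filter_mset is_loop G \<noteq> {#}" using loop(2) by (metis less_irrefl of_nat_0 size_empty)
      then obtain C where C: "C \<in># G" "is_loop C" by auto
      then have "valid_component C" using G(1) by (simp add: position_def)
      then show thesis
        by (cases rule: valid_component_cases) (use that C no4 False in auto)
    qed
    then obtain R where CR: "G = add_mset (Loop n) R" by (auto dest!: multi_member_split)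
    have R: "three_chains R = ?t" "four_loops R = 0" "longer_chains R = ?m" "loops R + 1 = ?L"
      "excess G = excess R + int n - 8"
      using CR n loop by auto
    have N: "int n = 6 \<or> int n \<ge> 6 \<and> excess R \<ge> - ?t"
    proof (cases "n = 6")
      case False
      then have "Loop 4 \<notin># R" "Loop 6 \<notin># R" using n(3) no4 CR by auto
      then show ?thesis using excess_ge[OF rest(1)[OF CR]] R(1) n(2) by linarith
    qed simp
    have pR: "predicted R = closed_form ?t 0 (loops R) ?m (excess R)"
      unfolding predicted_def R(1,2,3) ..
    have pG: "predicted G = closed_form ?t 0 (loops R + 1) ?m (excess R + int n - 8)"
      unfolding predicted_def R(4,5) loop(1) ..
    have F: "feasible ?t 0 (loops R) ?m (excess R)"
      using rest(2)[OF CR] unfolding R(1,2,3) .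
    have "int n - 4 + \<bar>predicted R - 4\<bar> \<le> predicted G"
    proof (cases "?t = 0")
      case True
      then show ?thesis using opened_loop_le_closed_form[of "loops R" "?m" "excess R" "int n"] F N
        unfolding pR pG by (simp only: minus_zero)
    next
      case False
      then have *: "?t = 1" "?m = 0" "c \<ge> 2" using loop(3) by blast+
      have "excess R + int n - 8 + bonus 1 (loops R + 1) 0 \<ge> 2"
        using \<open>c \<ge> 2\<close> unfolding c_def R(4,5) * .
      then show ?thesis
        using opened_loop_le_closed_form_single_3_chain[of "loops R" "excess R" "int n"] F N
        unfolding pR pG * by simp
    qed
    then show ?thesis
      using CR by (intro exI[of _ "Loop n"] exI[of _ R]) (simp add: opened_value_alt)
  next
    case three
    then have "Chain 3 \<in># G" by (cases "Chain 3 \<in># G") (simp_all add: not_in_iff)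
    then obtain R where CR: "G = add_mset (Chain 3) R" by (auto dest!: multi_member_split)
    note F = rest(2)[OF CR]
    let ?tR = "three_chains R"
    have R: "?t = ?tR + 1" "?f = four_loops R" "?m = longer_chains R" "?L = loops R"
      "excess G = excess R - 1"
      using CR by auto
    have c: "excess R - 1 + bonus (?tR + 1) (loops R) (longer_chains R) = c"
      unfolding c_def R ..
    have pG: "predicted G = closed_form (?tR + 1) (four_loops R) (loops R) (longer_chains R) (excess R - 1)"
      unfolding predicted_def R ..
    have "\<not> (?tR = 0 \<and> excess R mod 4 = 0 \<and> four_loops R > 0)"
      using three(2) mod_4_pred[of "excess R"] unfolding R tame_def by auto
    moreover have "\<not> (four_loops R > 0 \<and> loops R + longer_chains R > 1 \<and> c \<ge> -1)"
      using three(3) unfolding R by blast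
    moreover have "\<not> (?tR = 0 \<and> longer_chains R = 0 \<and> loops R > 0 \<and> c \<ge> 2)"
    proof
      assume *: "?tR = 0 \<and> longer_chains R = 0 \<and> loops R > 0 \<and> c \<ge> 2"
      then have "four_loops R \<noteq> 0" using three(4) unfolding R by auto
      then have f: "four_loops R > 0" by simp
      \<comment> \<open>Only \<open>3 + 4-loop\<close> remains, whose controlled value is 1.\<close>
      then have "loops R = 1" using three(3) * unfolding R by auto
      moreover have "four_loops R \<le> loops R" "loops R = four_loops R \<Longrightarrow> excess R = - 4 * loops R"
        using F * by (auto simp: feasible_def)
      ultimately have "excess R = -4" using f by linarith
      moreover have z: "?tR = 0" "longer_chains R = 0" using * by blast+
      have "excess R - 1 + bonus (0 + 1) 1 0 = c" using c unfolding z \<open>loops R = 1\<close> .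
      ultimately have "c = 1" by (simp add: bonus_def)
      then show False using * by simp
    qed
    ultimately have "1 + \<bar>predicted R - 2\<bar> \<le> predicted G"
      unfolding pG predicted_def[of R] using opened_3_chain_le_closed_form[OF F] unfolding c by blast
    then show ?thesis
      using CR by (intro exI[of _ "Chain 3"] exI[of _ R]) (simp add: opened_value_alt)
  qed
qed

text \<open>The recursion determines the values, and both bounds together say that the prediction satisfies it.\<close>
theorem game_value_eq_predicted: "position G \<Longrightarrow> game_value G = predicted G"
proof (induction "size G" arbitrary: G rule: less_induct)
  case less
  show ?case
  proof (cases "G = {#}")
    case True
    then show ?thesis by (simp add: game_value.simps predicted_def closed_form_def)
  next
    case False
    let ?opt = "\<lambda>C. opened_value C (game_value (G - {#C#}))"
    have eq: "?opt C = opened_value C (predicted R)" if "G = add_mset C R" for C R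
      using less that by (simp add: position_add)
    obtain C R where CR: "G = add_mset C R" "opened_value C (predicted R) \<le> predicted G"
      using ex_optimal_opening[OF less.prems False] by blast
    have "Min (?opt ` set_mset G) = predicted G"
    proof (rule antisym)
      show "Min (?opt ` set_mset G) \<le> predicted G"
        using CR eq[OF CR(1)] by (intro Min.coboundedI[THEN order_trans]) auto
      have "predicted G \<le> ?opt C" if "C \<in># G" for C
      proof -
        obtain R where R: "G = add_mset C R" using multi_member_split[OF \<open>C \<in># G\<close>] by blast
        then show ?thesis unfolding eq[OF R] using predicted_le_opened_value[of C R] less.prems by simp
      qed
      then show "predicted G \<le> Min (?opt ` set_mset G)" using False by auto
    qed
    then show ?thesis using False by (simp add: game_value.simps[of G])
  qed
qed

section \<open>Controlled value and number of boxes\<close>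

lemma excess_eq_boxes:
  "excess G = int (boxes G) - 4 * int (size (filter_mset is_chain G)) - 8 * int (size (filter_mset is_loop G))"
proof (induction G)
  case (add C R)
  then show ?case by (cases C) (simp_all add: boxes_def)
qed (simp add: boxes_def)

lemma terminal_bonus_eq:
  "terminal_bonus G = bonus (three_chains G) (loops G) (longer_chains G)"
proof -
  have long: "(\<forall>C\<in>#G. is_loop C \<or> C = Chain 3) \<longleftrightarrow> \<not> longer_chains G > 0"
    using component.exhaust_disc by auto
  have loop: "(\<exists>C\<in>#G. is_loop C) \<longleftrightarrow> loops G \<noteq> 0" by auto
  have three: "Chain 3 \<in># G \<longleftrightarrow> three_chains G \<noteq> 0" by (simp add: not_in_iff)
  have "\<not> is_loop (Chain 3)" by simp
  then have all: "(\<forall>C\<in>#G. is_loop C) \<longleftrightarrow> three_chains G = 0 \<and> \<not> longer_chains G > 0"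
    using long three by blast
  have empty: "G = {#} \<longleftrightarrow> loops G = 0 \<and> three_chains G = 0 \<and> \<not> longer_chains G > 0"
  proof -
    have "G = {#} \<longleftrightarrow> \<not> (\<exists>C\<in>#G. is_loop C) \<and> (\<forall>C\<in>#G. is_loop C)" by (cases G) auto
    then show ?thesis using loop all by blast
  qed
  define t L m where "t = three_chains G" and "L = loops G" and "m = longer_chains G"
  show ?thesis
    unfolding terminal_bonus_def bonus_def empty all long loop three t_def[symmetric] L_def[symmetric] m_def[symmetric]
    by simp
qed

lemma controlled_value_eq:
  "controlled_value G = excess G + bonus (three_chains G) (loops G) (longer_chains G)"
  by (simp add: controlled_value_def excess_eq_boxes terminal_bonus_eq)

lemma boxes_mod_4: "int (boxes G) mod 4 = excess G mod 4"
proof -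
  have "int (boxes G) = excess G + 4 * (int (size (filter_mset is_chain G)) + 2 * loops G)"
    by (simp add: excess_eq_boxes)
  then show ?thesis by (metis mod_mult_self2)
qed

lemma boxes_cong: "[boxes G = r] (mod 4) \<longleftrightarrow> excess G mod 4 = int r mod 4"
proof -
  have "[boxes G = r] (mod 4) \<longleftrightarrow> [int (boxes G) = int r] (mod 4)"
    using cong_int_iff[of "boxes G" r 4] by simp
  then show ?thesis unfolding cong_def[of "int (boxes G)"] boxes_mod_4 .
qed

lemma odd_boxes: "odd (boxes G) \<longleftrightarrow> odd (excess G)"
proof -
  have "odd (int (boxes G)) \<longleftrightarrow> odd (excess G)" using boxes_mod_4[of G] by presburger
  then show ?thesis by simp
qed

text \<open>The exceptional position is recognised by its counts: no loop but the 4-loop, no longer chain, and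
exactly two 3-chains.\<close>
lemma ex_rest_not_two_3_chains:
  "(\<exists>H. G = {#Loop 4#} + H \<and> H \<noteq> {#Chain 3, Chain 3#}) \<longleftrightarrow>
    four_loops G > 0 \<and> \<not> (three_chains G = 2 \<and> four_loops G = 1 \<and> loops G = 1 \<and> longer_chains G = 0)"
proof (cases "Loop 4 \<in># G")
  case False
  then show ?thesis by (auto simp: not_in_iff)
next
  case True
  then obtain R where R: "G = add_mset (Loop 4) R" by (auto dest!: multi_member_split)
  have "R = {#Chain 3, Chain 3#} \<longleftrightarrow> three_chains R = 2 \<and> four_loops R = 0 \<and> loops R = 0 \<and> longer_chains R = 0"
    (is "_ \<longleftrightarrow> ?counts")
  proof
    assume ?counts
    then have "C = Chain 3" if "C \<in># R" for C
      using that component.exhaust_disc by auto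
    then have R3: "R = replicate_mset (size R) (Chain 3)"
      using set_mset_subset_singletonD[of R "Chain 3"] by auto
    have "count R (Chain 3) = size R"
      using arg_cong[OF R3, of "\<lambda>M. count M (Chain 3)"] by simp
    then have "size R = 2" using \<open>?counts\<close> by simp
    then show "R = {#Chain 3, Chain 3#}" using R3 by (simp add: numeral_2_eq_2)
  qed simp
  then show ?thesis using R by auto
qed

lemma dist_mult_8_values:
  "[c = 0] (mod 8) \<Longrightarrow> dist_mult 8 c = 0"
  "[c = 1] (mod 8) \<or> [c = -1] (mod 8) \<Longrightarrow> dist_mult 8 c = 1"
  "[c = 2] (mod 8) \<or> [c = -2] (mod 8) \<Longrightarrow> dist_mult 8 c = 2"
  "[c = 3] (mod 8) \<or> [c = -3] (mod 8) \<Longrightarrow> dist_mult 8 c = 3"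
  "[c = 4] (mod 8) \<Longrightarrow> dist_mult 8 c = 4"
  by (auto simp: cong_def dist_mult_def)

lemma dist_mult_4_values:
  "odd c \<Longrightarrow> dist_mult 4 c = 1"
  "c mod 4 = 2 \<Longrightarrow> dist_mult 4 c = 2"
  "c mod 4 = 0 \<Longrightarrow> dist_mult 4 c = 0"
proof -
  assume "odd c"
  then have "c mod 4 = 1 \<or> c mod 4 = 3" by presburger
  then show "dist_mult 4 c = 1" by (auto simp: dist_mult_def)
qed (simp_all add: dist_mult_def)

theorem theorem4p1:
  fixes G :: "component multiset" and v c :: int and \<theta> f :: nat
  assumes "position G" and "G \<noteq> {#}"
    and "v = game_value G"
    and "c = controlled_value G"
    and "\<theta> = count G (Chain 3)"
    and "f = count G (Loop 4)"
  shows
    "if c \<ge> 2 then v = c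
     else if c = 0 \<and> (\<exists>H. G = {#Loop 4#} + H \<and> H \<noteq> {#Chain 3, Chain 3#}) then v = 0
     else if \<theta> = 0 \<or> (\<theta> = 1 \<and> [boxes G = 3] (mod 4)) then
       (if c + 4 * int f \<ge> 2 then
          ([c = 0] (mod 8) \<longrightarrow> v = 0) \<and>
          ([c = 1] (mod 8) \<or> [c = -1] (mod 8) \<longrightarrow> v = 1) \<and>
          ([c = 2] (mod 8) \<or> [c = -2] (mod 8) \<longrightarrow> v = 2) \<and>
          ([c = 3] (mod 8) \<or> [c = -3] (mod 8) \<longrightarrow> v = 3) \<and>
          ([c = 4] (mod 8) \<longrightarrow> v = 4)
        else
          (odd (boxes G) \<longrightarrow> v = (if odd f then 1 else 3)) \<and>
          ([boxes G = 2] (mod 4) \<longrightarrow> v = 2) \<and>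
          ([boxes G = 0] (mod 4) \<longrightarrow> v = (if odd f then 0 else 4)))
     else v = (if odd (boxes G) then 1 else 2)"
proof -
  let ?a = "excess G" and ?L = "loops G" and ?m = "longer_chains G"
  have c: "c = ?a + bonus (int \<theta>) ?L ?m" using assms(4,5) controlled_value_eq by simp
  have nonempty: "\<not> (int \<theta> = 0 \<and> ?L = 0 \<and> ?m = 0)"
  proof
    assume *: "int \<theta> = 0 \<and> ?L = 0 \<and> ?m = 0"
    obtain C where "C \<in># G" using assms(2) by blast
    then show False using * assms(5) by (cases C) (auto simp flip: not_in_iff)
  qed
  have exH: "(\<exists>H. G = {#Loop 4#} + H \<and> H \<noteq> {#Chain 3, Chain 3#}) \<longleftrightarrow>
      int f > 0 \<and> \<not> (int \<theta> = 2 \<and> int f = 1 \<and> ?L = 1 \<and> ?m = 0)"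
    unfolding assms(5,6) by (rule ex_rest_not_two_3_chains)
  have tame: "(\<theta> = 0 \<or> (\<theta> = 1 \<and> [boxes G = 3] (mod 4))) \<longleftrightarrow> tame (int \<theta>) ?a"
    by (auto simp: tame_def boxes_cong)
  have v: "v = (if c \<ge> 2 then c
     else if c = 0 \<and> int f > 0 \<and> \<not> (int \<theta> = 2 \<and> int f = 1 \<and> ?L = 1 \<and> ?m = 0) then 0
     else if tame (int \<theta>) ?a then low c (int f) else if odd (boxes G) then 1 else 2)"
    using game_value_eq_predicted[OF assms(1)]
    unfolding predicted_def closed_form_def Let_def assms(5,6)[symmetric] c[symmetric] if_not_P[OF nonempty]
      odd_boxes assms(3) .
  have parity: "odd c \<longleftrightarrow> odd (boxes G)" using even_excess_add_bonus c odd_boxes by simp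
  \<comment> \<open>A single 3-chain among loops has bonus 6, but then the number of boxes is odd.\<close>
  have mod4: "c mod 4 = ?a mod 4" if "tame (int \<theta>) ?a" "even ?a"
  proof -
    have "\<theta> = 0" using that mod_4_3_odd[of ?a] by (auto simp: tame_def)
    then show ?thesis using bonus_4[of ?L ?m] c by (auto elim!: dvdE)
  qed
  have A: "([c = 0] (mod 8) \<longrightarrow> low c (int f) = 0) \<and>
          ([c = 1] (mod 8) \<or> [c = -1] (mod 8) \<longrightarrow> low c (int f) = 1) \<and>
          ([c = 2] (mod 8) \<or> [c = -2] (mod 8) \<longrightarrow> low c (int f) = 2) \<and>
          ([c = 3] (mod 8) \<or> [c = -3] (mod 8) \<longrightarrow> low c (int f) = 3) \<and>
          ([c = 4] (mod 8) \<longrightarrow> low c (int f) = 4)" if "c + 4 * int f \<ge> 2"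
    using that dist_mult_8_values[of c] by (simp add: low_def)
  have B: "(odd (boxes G) \<longrightarrow> low c (int f) = (if odd f then 1 else 3)) \<and>
          ([boxes G = 2] (mod 4) \<longrightarrow> low c (int f) = 2) \<and>
          ([boxes G = 0] (mod 4) \<longrightarrow> low c (int f) = (if odd f then 0 else 4))"
    if "\<not> c + 4 * int f \<ge> 2" "tame (int \<theta>) ?a"
  proof -
    have low_c: "low c (int f) = (if odd f then dist_mult 4 c else 4 - dist_mult 4 c)"
      using that(1) by (simp add: low_def)
    have "c mod 4 = ?a mod 4" if "?a mod 4 = 0 \<or> ?a mod 4 = 2"
    proof -
      have "even ?a" using that by presburger
      then show ?thesis using mod4 \<open>tame (int \<theta>) ?a\<close> by simp
    qed
    then show ?thesis unfolding low_c using dist_mult_4_values[of c] parity by (simp add: boxes_cong)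
  qed
  show ?thesis unfolding exH tame using v A B by (smt (verit))
qed

end
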